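(* Let $T$ be a truss, $M$ a left $T$-module and $N$ a subset of $M$. Then the following statements are equivalent: (1) $N$ is an induced submodule of $M$. (2) $N$ is a sub-heap of $M$ and there is a congruence $\sim$ on the $T$-module $M$ such that $\pi_N=\pi_\sim$. (3) $N$ is an equivalence class of a congruence on the $T$-module $M$.
   Context: A heap is a set $H$ with a ternary operation $[-,-,-]$ such that $[[a,b,c],d,e]=[a,b,[c,d,e]]$ and $[b,b,a]=a=[a,b,b]$ for all elements; it is abelian if $[a,b,c]=[c,b,a]$. A sub-heap is a subset closed under the ternary operation. A truss is an abelian heap $T$ with an associative binary multiplication such that $a[b,c,d]=[ab,ac,ad]$ and $[b,c,d]a=[ba,ca,da]$ for all $a,b,c,d\in T$. A left $T$-module is an abelian heap $M$ with an action $T\times M\to M$, $(t,m)\mapsto t\cdot m$, such that $t\cdot(t'\cdot m)=(tt')\cdot m$, $[t,t',t'']\cdot m=[t\cdot m,t'\cdot m,t''\cdot m]$ and $t\cdot[m,m',m'']=[t\cdot m,t\cdot m',t\cdot m'']$. An induced submodule of $M$ is a sub-heap $N\subseteq M$ such that $[t\cdot e',t\cdot e,e]\in N$ for all $e,e'\in N$ and $t\in T$. For a sub-heap $N\subseteq M$, the sub-heap relation is $x\sim_N y\iff \exists\, n\in N,\ [x,y,n]\in N$; $M/N$ denotes the set of equivalence classes of this relation, and $\pi_N:M\to M/N$ the canonical map sending an element to its class. A congruence on a $T$-module $M$ is an equivalence relation compatible with the heap operation and with the action of every $t\in T$; $\pi_\sim: M\to M/{\sim}$ sends an element to its equivalence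 class.
   Formalization: The subset N is assumed nonempty: the empty set is vacuously a sub-heap and an induced submodule, but it is never an equivalence class, so the equivalence of (1) and (3) fails for empty N. *)

theory Defs
  imports "HOL-Library.FuncSet"
begin

text \<open>
  Heaps are allowed to be empty, and so are sub-heaps and induced submodules below;
  an equivalence class never is, so relating them requires a nonemptiness hypothesis.
\<close>

locale heap =
  fixes H :: "'a set" and tern :: "'a \<Rightarrow> 'a \<Rightarrow> 'a \<Rightarrow> 'a"
  assumes tern_closed: "\<lbrakk>a \<in> H; b \<in> H; c \<in> H\<rbrakk> \<Longrightarrow> tern a b c \<in> H"
    and tern_assoc: "\<lbrakk>a \<in> H; b \<in> H; c \<in> H; d \<in> H; e \<in> H\<rbrakk>
      \<Longrightarrow> tern (tern a b c) d e = tern a b (tern c d e)"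
    and malcev_left: "\<lbrakk>a \<in> H; b \<in> H\<rbrakk> \<Longrightarrow> tern b b a = a"
    and malcev_right: "\<lbrakk>a \<in> H; b \<in> H\<rbrakk> \<Longrightarrow> tern a b b = a"

locale abelian_heap = heap +
  assumes tern_commute: "\<lbrakk>a \<in> H; b \<in> H; c \<in> H\<rbrakk> \<Longrightarrow> tern a b c = tern c b a"

locale truss = abelian_heap T tern
  for T :: "'t set" and tern :: "'t \<Rightarrow> 't \<Rightarrow> 't \<Rightarrow> 't" +
  fixes mul :: "'t \<Rightarrow> 't \<Rightarrow> 't"
  assumes mul_closed: "\<lbrakk>a \<in> T; b \<in> T\<rbrakk> \<Longrightarrow> mul a b \<in> T"
    and mul_assoc: "\<lbrakk>a \<in> T; b \<in> T; c \<in> T\<rbrakk> \<Longrightarrow> mul (mul a b) c = mul a (mul b c)"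
    and distrib_left: "\<lbrakk>a \<in> T; b \<in> T; c \<in> T; d \<in> T\<rbrakk>
      \<Longrightarrow> mul a (tern b c d) = tern (mul a b) (mul a c) (mul a d)"
    and distrib_right: "\<lbrakk>a \<in> T; b \<in> T; c \<in> T; d \<in> T\<rbrakk>
      \<Longrightarrow> mul (tern b c d) a = tern (mul b a) (mul c a) (mul d a)"

locale left_truss_module =
  truss T ternT mul + M: abelian_heap M ternM
  for T :: "'t set" and ternT :: "'t \<Rightarrow> 't \<Rightarrow> 't \<Rightarrow> 't" and mul :: "'t \<Rightarrow> 't \<Rightarrow> 't"
    and M :: "'m set" and ternM :: "'m \<Rightarrow> 'm \<Rightarrow> 'm \<Rightarrow> 'm" +
  fixes act :: "'t \<Rightarrow> 'm \<Rightarrow> 'm"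
  assumes act_closed: "\<lbrakk>t \<in> T; m \<in> M\<rbrakk> \<Longrightarrow> act t m \<in> M"
    and act_act: "\<lbrakk>t \<in> T; t' \<in> T; m \<in> M\<rbrakk> \<Longrightarrow> act t (act t' m) = act (mul t t') m"
    and act_tern_left: "\<lbrakk>t \<in> T; t' \<in> T; t'' \<in> T; m \<in> M\<rbrakk>
      \<Longrightarrow> act (ternT t t' t'') m = ternM (act t m) (act t' m) (act t'' m)"
    and act_tern_right: "\<lbrakk>t \<in> T; m \<in> M; m' \<in> M; m'' \<in> M\<rbrakk>
      \<Longrightarrow> act t (ternM m m' m'') = ternM (act t m) (act t m') (act t m'')"

definition sub_heap :: "'a set \<Rightarrow> ('a \<Rightarrow> 'a \<Rightarrow> 'a \<Rightarrow> 'a) \<Rightarrow> 'a set \<Rightarrow> bool" where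
  "sub_heap H tern N \<longleftrightarrow> N \<subseteq> H \<and> (\<forall>a\<in>N. \<forall>b\<in>N. \<forall>c\<in>N. tern a b c \<in> N)"

definition induced_submodule ::
  "'t set \<Rightarrow> 'm set \<Rightarrow> ('m \<Rightarrow> 'm \<Rightarrow> 'm \<Rightarrow> 'm) \<Rightarrow> ('t \<Rightarrow> 'm \<Rightarrow> 'm) \<Rightarrow> 'm set \<Rightarrow> bool" where
  "induced_submodule T M tern act N \<longleftrightarrow>
     sub_heap M tern N \<and> (\<forall>t\<in>T. \<forall>e\<in>N. \<forall>e'\<in>N. tern (act t e') (act t e) e \<in> N)"

definition sub_heap_rel :: "'a set \<Rightarrow> ('a \<Rightarrow> 'a \<Rightarrow> 'a \<Rightarrow> 'a) \<Rightarrow> 'a set \<Rightarrow> ('a \<times> 'a) set" where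
  "sub_heap_rel H tern N = {(x, y). x \<in> H \<and> y \<in> H \<and> (\<exists>n\<in>N. tern x y n \<in> N)}"

definition module_congruence ::
  "'t set \<Rightarrow> 'm set \<Rightarrow> ('m \<Rightarrow> 'm \<Rightarrow> 'm \<Rightarrow> 'm) \<Rightarrow> ('t \<Rightarrow> 'm \<Rightarrow> 'm) \<Rightarrow> ('m \<times> 'm) set \<Rightarrow> bool" where
  "module_congruence T M tern act R \<longleftrightarrow>
     equiv M R \<and>
     (\<forall>x x' y y' z z'. (x, x') \<in> R \<and> (y, y') \<in> R \<and> (z, z') \<in> R
        \<longrightarrow> (tern x y z, tern x' y' z') \<in> R) \<and>
     (\<forall>t\<in>T. \<forall>x x'. (x, x') \<in> R \<longrightarrow> (act t x, act t x') \<in> R)"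

text \<open>
  The canonical map \<open>A \<rightarrow> A // R\<close>. Its codomain is its image, so equality of two
  such maps with the same domain \<open>A\<close> also forces the quotient sets to be equal.
\<close>
definition canonical_map :: "'a set \<Rightarrow> ('a \<times> 'a) set \<Rightarrow> 'a \<Rightarrow> 'a set" where
  "canonical_map A R = (\<lambda>x\<in>A. R `` {x})"

end

theory Submission
  imports Defs
begin

text \<open>
  Reading \<open>[x, y, z]\<close> as \<open>x - y + z\<close>, the relation \<open>\<sim>\<^sub>N\<close> says that \<open>x - y\<close> translates a point
  of \<open>N\<close> into \<open>N\<close>; it is then independent of the point, and \<open>N\<close> is one of its classes.
  Compatibility with the heap operation is the medial law
  \<open>[[x, y, z], [x', y', z'], [n, n, n]] = [[x, x', n], [y, y', n], [z, z', n]]\<close>.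
  If \<open>n' = [x, y, n]\<close> then \<open>[tx, ty, n] = [[tx, ty, tn], tn, n] = [tn', tn, n]\<close>, so compatibility
  with the action is exactly the induced submodule condition. Conversely, for \<open>e, e'\<close> in
  a class of a congruence, \<open>[te', te, e] \<sim> [te, te, e] = e\<close>.
\<close>

context heap
begin

lemma tern_cancel_left:
  assumes "x \<in> H" "y \<in> H" "z \<in> H" "w \<in> H"
  shows "tern x y (tern y z w) = tern x z w"
  using assms tern_assoc[of x y y z w] by (simp add: malcev_right)

lemma tern_cancel_right:
  assumes "x \<in> H" "y \<in> H" "z \<in> H" "w \<in> H"
  shows "tern (tern x y z) z w = tern x y w"
  using assms by (simp add: tern_assoc malcev_left)

text \<open>Group analogue: inverting \<open>b c^-1 d\<close> gives \<open>d^-1 c b^-1\<close>. No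
  commutativity enters.\<close>

lemma tern_middle:
  assumes "a \<in> H" "b \<in> H" "c \<in> H" "d \<in> H" "e \<in> H"
  shows "tern a (tern b c d) e = tern a d (tern c b e)"
proof -
  let ?p = "tern b c d"
  \<comment> \<open>Writing \<open>a\<close> as a term that ends in \<open>?p\<close> lets the
    middle entry \<open>?p\<close> cancel below.\<close>
  have "tern (tern a d c) b ?p = a"
    using assms by (simp add: tern_cancel_left tern_assoc tern_closed malcev_left malcev_right)
  then have "tern a ?p e = tern (tern (tern a d c) b ?p) ?p e"
    by simp
  also have "\<dots> = tern (tern a d c) b e"
    using assms by (intro tern_cancel_right) (auto intro: tern_closed)
  finally show ?thesis
    using assms by (simp add: tern_assoc)
qed

end

context abelian_heap
begin

text \<open>In \<open>a - b + c - d + e\<close> this swaps the positive entries \<open>a\<close> and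
  \<open>c\<close>; the inner variant swaps the negative ones. With \<open>tern_commute\<close> they
  act as ordered rewrite rules.\<close>

lemma tern_left_commute_outer:
  assumes "a \<in> H" "b \<in> H" "c \<in> H" "d \<in> H" "e \<in> H"
  shows "tern a b (tern c d e) = tern c b (tern a d e)"
  using assms by (metis tern_assoc tern_commute)

lemma tern_left_commute_inner:
  assumes "a \<in> H" "b \<in> H" "c \<in> H" "d \<in> H" "e \<in> H"
  shows "tern a b (tern c d e) = tern a d (tern c b e)"
  using assms by (metis tern_middle tern_commute)

text \<open>Both sides flatten to one alternating sum, with \<open>a1, c1, b2, a3, c3\<close>
  positive and \<open>b1, a2, c2, b3\<close> negative.\<close>

lemma tern_medial:
  assumes "a1 \<in> H" "b1 \<in> H" "c1 \<in> H" "a2 \<in> H" "b2 \<in> H" "c2 \<in> H" "a3 \<in> H" "b3 \<in> H" "c3 \<in> H"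
  shows "tern (tern a1 b1 c1) (tern a2 b2 c2) (tern a3 b3 c3)
    = tern (tern a1 a2 a3) (tern b1 b2 b3) (tern c1 c2 c3)"
  using assms
  by (simp add: tern_assoc tern_middle tern_closed tern_left_commute_outer
      tern_left_commute_inner tern_commute)

context
  fixes N assumes sub: "sub_heap H tern N"
begin

lemma sub_heap_subsetD: "n \<in> N \<Longrightarrow> n \<in> H"
  using sub by (auto simp: sub_heap_def)

lemma sub_heap_closed: "\<lbrakk>a \<in> N; b \<in> N; c \<in> N\<rbrakk> \<Longrightarrow> tern a b c \<in> N"
  using sub by (auto simp: sub_heap_def)

text \<open>The base point moves from \<open>m\<close> to \<open>n\<close> by
  \<open>[[x, y, m], m, n] = [x, y, n]\<close>, so one fixed \<open>n\<close> can replace the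
  existential.\<close>

lemma sub_heap_rel_base_point:
  assumes "n \<in> N"
  shows "(x, y) \<in> sub_heap_rel H tern N \<longleftrightarrow> x \<in> H \<and> y \<in> H \<and> tern x y n \<in> N"
proof -
  have "tern x y n \<in> N" if "x \<in> H" "y \<in> H" "m \<in> N" "tern x y m \<in> N" for m
  proof -
    have "tern (tern x y m) m n \<in> N"
      using that(3,4) assms sub_heap_closed by simp
    then show ?thesis
      using that assms by (simp add: tern_cancel_right sub_heap_subsetD)
  qed
  then show ?thesis
    using assms by (auto simp: sub_heap_rel_def)
qed

lemma equiv_sub_heap_rel:
  assumes "N \<noteq> {}"
  shows "equiv H (sub_heap_rel H tern N)"
proof -
  obtain n where n: "n \<in> N" "n \<in> H"
    using assms sub_heap_subsetD by blast
  note rel = sub_heap_rel_base_point[OF n(1)]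
  show ?thesis
  proof (rule equivI)
    show "sub_heap_rel H tern N \<subseteq> H \<times> H"
      by (auto simp: sub_heap_rel_def)
    show "refl_on H (sub_heap_rel H tern N)"
      using n by (auto simp: refl_on_def rel malcev_left)
    show "sym (sub_heap_rel H tern N)"
    proof (rule symI)
      fix x y assume xy: "(x, y) \<in> sub_heap_rel H tern N"
      \<comment> \<open>Symmetry takes \<open>[x, y, n]\<close>, itself in \<open>N\<close>, as the
        new base point.\<close>
      then have "tern y x (tern x y n) = n"
        using n by (simp add: rel tern_cancel_left malcev_left)
      then show "(y, x) \<in> sub_heap_rel H tern N"
        using xy n(1) rel[of x y] sub_heap_rel_base_point[of "tern x y n" y x] by simp
    qed
    show "trans (sub_heap_rel H tern N)"
    proof (rule transI)
      fix x y z
      assume xy: "(x, y) \<in> sub_heap_rel H tern N" and yz: "(y, z) \<in> sub_heap_rel H tern N"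
      then have "tern y z n \<in> N"
        by (simp add: rel)
      \<comment> \<open>Here the base point is \<open>[y, z, n]\<close>, so that \<open>y\<close>
        cancels.\<close>
      then have "tern x y (tern y z n) \<in> N"
        using xy sub_heap_rel_base_point by blast
      then show "(x, z) \<in> sub_heap_rel H tern N"
        using xy yz n by (simp add: rel tern_cancel_left)
    qed
  qed
qed

lemma sub_heap_rel_tern:
  assumes "N \<noteq> {}" "(x, x') \<in> sub_heap_rel H tern N" "(y, y') \<in> sub_heap_rel H tern N"
    "(z, z') \<in> sub_heap_rel H tern N"
  shows "(tern x y z, tern x' y' z') \<in> sub_heap_rel H tern N"
proof -
  obtain n where n: "n \<in> N" "n \<in> H"
    using assms(1) sub_heap_subsetD by blast
  note rel = sub_heap_rel_base_point[OF n(1)]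
  have "tern (tern x x' n) (tern y y' n) (tern z z' n) \<in> N"
    using assms by (auto simp: rel intro: sub_heap_closed)
  moreover have "tern (tern x x' n) (tern y y' n) (tern z z' n)
      = tern (tern x y z) (tern x' y' z') (tern n n n)"
    using assms n by (intro tern_medial) (auto simp: rel)
  ultimately show ?thesis
    using assms n by (simp add: rel malcev_left tern_closed)
qed

lemma sub_heap_in_quotient:
  assumes "N \<noteq> {}"
  shows "N \<in> H // sub_heap_rel H tern N"
proof -
  obtain n where n: "n \<in> N" "n \<in> H"
    using assms sub_heap_subsetD by blast
  \<comment> \<open>With \<open>n\<close> second, the test is \<open>[y, n, n] = y\<close>; symmetry
    then turns this into the class of \<open>n\<close>.\<close>
  have "(y, n) \<in> sub_heap_rel H tern N \<longleftrightarrow> y \<in> N" for y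
    using n sub_heap_subsetD by (auto simp: sub_heap_rel_base_point[OF n(1)] malcev_right)
  then have "N = sub_heap_rel H tern N `` {n}"
    using equiv_sub_heap_rel[OF assms] by (auto elim!: equivE dest: symD)
  then show ?thesis
    using n(2) by (metis quotientI)
qed

end

end

context left_truss_module
begin

lemma module_congruence_sub_heap_rel:
  assumes ind: "induced_submodule T M ternM act N" and "N \<noteq> {}"
  shows "module_congruence T M ternM act (sub_heap_rel M ternM N)"
proof -
  have sub: "sub_heap M ternM N"
    using ind by (simp add: induced_submodule_def)
  obtain n where n: "n \<in> N" "n \<in> M"
    using assms(2) M.sub_heap_subsetD[OF sub] by blast
  note rel = M.sub_heap_rel_base_point[OF sub n(1)]
  have "(act t x, act t y) \<in> sub_heap_rel M ternM N"
    if t: "t \<in> T" and xy: "(x, y) \<in> sub_heap_rel M ternM N" for t x y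
  proof -
    have "ternM (act t (ternM x y n)) (act t n) n \<in> N"
      using ind t xy n by (auto simp: induced_submodule_def rel)
    then show ?thesis
      using t xy n by (simp add: rel act_closed act_tern_right M.tern_cancel_right)
  qed
  then show ?thesis
    unfolding module_congruence_def
    using M.equiv_sub_heap_rel[OF sub assms(2)] M.sub_heap_rel_tern[OF sub assms(2)] by blast
qed

lemma induced_submodule_congruence_class:
  assumes cong: "module_congruence T M ternM act R" and N: "N \<in> M // R"
  shows "induced_submodule T M ternM act N"
proof -
  have eq: "equiv M R"
    and tern: "\<lbrakk>(x, x') \<in> R; (y, y') \<in> R; (z, z') \<in> R\<rbrakk>
      \<Longrightarrow> (ternM x y z, ternM x' y' z') \<in> R"
    and act: "\<lbrakk>t \<in> T; (x, x') \<in> R\<rbrakk> \<Longrightarrow> (act t x, act t x') \<in> R" for t x x' y y' z z'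
    using cong by (auto simp: module_congruence_def)
  have NM: "N \<subseteq> M"
    using in_quotient_imp_subset[OF eq N] .
  have refl: "(x, x) \<in> R" if "x \<in> M" for x
    using eq that by (auto elim: equivE dest: refl_onD)
  have rel: "(x, y) \<in> R" if "x \<in> N" "y \<in> N" for x y
    using in_quotient_imp_in_rel[OF eq N] that by simp
  have closed: "x \<in> N" if "e \<in> N" "(x, e) \<in> R" for x e
    using in_quotient_imp_closed[OF eq N] that eq by (meson equivE symD)
  \<comment> \<open>All three entries are related to \<open>a\<close>, hence
    \<open>[a, b, c]\<close> is related to \<open>[a, a, a] = a\<close>.\<close>
  have "ternM a b c \<in> N" if "a \<in> N" "b \<in> N" "c \<in> N" for a b c
    using closed[of a] tern[OF rel[of a a] rel[of b a] rel[of c a]] that NM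
    by (auto simp: M.malcev_left subset_iff)
  moreover have "ternM (act t e') (act t e) e \<in> N" if "t \<in> T" "e \<in> N" "e' \<in> N" for t e e'
  proof -
    have "e \<in> M" "act t e \<in> M"
      using that NM act_closed by auto
    then have "(ternM (act t e') (act t e) e, e) \<in> R"
      using tern[OF act[OF that(1) rel[OF that(3,2)]] refl refl, of "act t e" e]
      by (simp add: M.malcev_left)
    then show ?thesis
      using closed that by blast
  qed
  ultimately show ?thesis
    using NM by (auto simp: induced_submodule_def sub_heap_def)
qed

end

lemma quotient_eq_canonical_map_image: "A // R = canonical_map A R ` A"
  by (auto simp: quotient_def canonical_map_def)

theorem theorem3p1:
  fixes T :: "'t set" and ternT :: "'t \<Rightarrow> 't \<Rightarrow> 't \<Rightarrow> 't" and mul :: "'t \<Rightarrow> 't \<Rightarrow> 't"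
    and M :: "'m set" and ternM :: "'m \<Rightarrow> 'm \<Rightarrow> 'm \<Rightarrow> 'm" and act :: "'t \<Rightarrow> 'm \<Rightarrow> 'm"
    and N :: "'m set"
  assumes "left_truss_module T ternT mul M ternM act"
    and "N \<subseteq> M"
    and "N \<noteq> {}"
  shows "(induced_submodule T M ternM act N \<longleftrightarrow>
            sub_heap M ternM N \<and>
            (\<exists>R. module_congruence T M ternM act R \<and>
                 canonical_map M (sub_heap_rel M ternM N) = canonical_map M R))
       \<and> (induced_submodule T M ternM act N \<longleftrightarrow>
            (\<exists>R. module_congruence T M ternM act R \<and> N \<in> M // R))"
proof -
  interpret left_truss_module T ternT mul M ternM act
    by fact
  let ?S = "sub_heap_rel M ternM N"
  \<comment> \<open>The witness in (2) and in (3) is \<open>?S\<close> itself, so the equality of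
    maps in (2) is reflexivity.\<close>
  have one_imp: "sub_heap M ternM N \<and> module_congruence T M ternM act ?S \<and> N \<in> M // ?S"
    if "induced_submodule T M ternM act N"
    using that module_congruence_sub_heap_rel M.sub_heap_in_quotient assms(3)
    by (auto simp: induced_submodule_def)
  \<comment> \<open>\<open>N\<close> is a class of \<open>?S\<close>, and equal canonical maps have
    equal images, so it is a class of \<open>R\<close>.\<close>
  have two_imp: "N \<in> M // R"
    if "sub_heap M ternM N" "canonical_map M ?S = canonical_map M R" for R
    using M.sub_heap_in_quotient[OF that(1) assms(3)] that(2)
    by (simp add: quotient_eq_canonical_map_image)
  show ?thesis
    using one_imp two_imp induced_submodule_congruence_class by blast
qed

end
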